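(* Let $q$ be a prime power. For each positive integer $m$, there is an $\mathbb{F}_q$-subspace $\mathcal{M}$ of $M_{3m}(\mathbb{F}_q)$ of dimension $3m$ in which the elements of determinant zero form a subspace of dimension $m$, and the non-zero elements of this subspace of dimension $m$ have rank $2m$.
   Context: $M_n(\mathbb{F}_q)$ is the $\mathbb{F}_q$-vector space of $n\times n$ matrices over $\mathbb{F}_q$. *)

theory Defs
  imports
    "Jordan_Normal_Form.DL_Rank"
    "Jordan_Normal_Form.Determinant"
    "HOL-Number_Theory.Prime_Powers"
begin

abbreviation square_mat_space :: "'a :: field itself \<Rightarrow> nat \<Rightarrow> ('a, 'a mat) module"
  where "square_mat_space ty n \<equiv> module_mat ty n n"

(* In the VectorSpace entry a subspace is a set of vectors; its dimension is that of the
   ambient module record with the carrier replaced by this set. *)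
abbreviation mat_subspace_dim :: "nat \<Rightarrow> 'a :: field mat set \<Rightarrow> nat"
  where "mat_subspace_dim n W \<equiv>
    vectorspace.dim class_ring ((square_mat_space TYPE('a) n)\<lparr>carrier := W\<rparr>)"

end

(* A vector space over F_q of cardinality q^n has dimension n, so all dimensions and ranks below are
   found by counting. Let K be the subfield of order q^m of the algebraic closure of F_q, and let a
   lie in the subfield of order q^(3m) but not in K. The norm of y + x a over K is a cubic form
   y^3 + d x y^2 + e x^2 y - c x^3 over K with no non-trivial zero. It is the determinant of

      [ y      z        c x     ]
      [ x   y + d x   e x + z   ]
      [ 0     - x        y      ]

   whatever z is. So in this 3-dimensional K-space of matrices the singular elements are those with
   x = y = 0, and those with z nonzero have rank 2. Reading the matrices as F_q-linear maps on K^3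
   multiplies all dimensions by m. *)

theory Submission
  imports
    Defs
    "HOL-Algebra.Algebraic_Closure_Type"
    "HOL-Library.Cardinality"
    "HOL-Library.Product_Plus"
    "HOL-Number_Theory.Residues"
    "Berlekamp_Zassenhaus.Berlekamp_Type_Based"
begin

subsection \<open>Finite subfields of the algebraic closure\<close>

lemma one_less_card_field: "CARD('a :: {field, finite}) > 1"
proof -
  have "card {0, 1 :: 'a} \<le> CARD('a)" by (intro card_mono) auto
  thus ?thesis by simp
qed

text \<open>Multiplication by a nonzero \<open>c\<close> permutes the nonzero elements, so it leaves
  their product unchanged; comparing the two products and cancelling gives the claim.\<close>

lemma finite_field_power_card:
  fixes c :: "'a :: {field, finite}"
  shows "c ^ CARD('a) = c"
proof (cases "c = 0")
  case False
  have "c * (\<Prod>y\<in>UNIV-{0}. c * y) = c * c ^ (CARD('a) - 1) * \<Prod>(UNIV-{0})"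
    by (simp add: prod.distrib mult_ac)
  also have "c * c ^ (CARD('a) - 1) = c ^ CARD('a)"
    by (metis Suc_diff_1 power_Suc zero_less_card_finite)
  also have "(\<Prod>y\<in>UNIV-{0}. c * y) = (\<Prod>y\<in>UNIV-{0}. y)"
    by (rule prod.reindex_bij_witness[of _ "\<lambda>y. y / c" "\<lambda>y. c * y"]) (use False in auto)
  finally show ?thesis
    by simp
qed (auto simp: zero_power)

text \<open>As \<open>N\<close> vanishes in the field, X^N - X has derivative -1. It therefore has
  no double root, and over an algebraically closed field its N roots are distinct.\<close>

lemma card_power_fixed_points:
  assumes N: "of_nat N = (0 :: 'b :: alg_closed_field)" "N > 1"
  shows "card {x :: 'b. x ^ N = x} = N" "finite {x :: 'b. x ^ N = x}"
proof -
  define p where "p = Polynomial.monom (1 :: 'b) N - [:0, 1:]"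
  have deg: "Polynomial.degree p = N"
    unfolding p_def diff_conv_add_uminus
    using N(2) by (subst Polynomial.degree_add_eq_left) (auto simp: degree_monom_eq)
  hence "p \<noteq> 0" using N(2) by auto
  have roots: "{x. poly p x = 0} = {x. x ^ N = x}"
    by (auto simp: p_def poly_monom)
  obtain A where A: "size A = N" "p = smult (Polynomial.lead_coeff p) (\<Prod>x\<in>#A. [:-x, 1:])"
    using alg_closed_imp_factorization[OF \<open>p \<noteq> 0\<close>] deg by metis
  have lc: "Polynomial.lead_coeff p \<noteq> 0" using \<open>p \<noteq> 0\<close> by simp
  have setA: "set_mset A = {x. poly p x = 0}"
    by (subst A(2)) (use lc in \<open>auto simp: poly_prod_mset prod_mset_zero_iff\<close>)
  have count_le: "count A a \<le> 1" for a
  proof (rule ccontr)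
    assume "\<not> count A a \<le> 1"
    hence "count {#a, a#} x \<le> count A x" for x by auto
    hence "{#a, a#} \<subseteq># A" by (intro mset_subset_eqI)
    then obtain B where "A = {#a, a#} + B" by (metis subset_mset.le_iff_add)
    hence "p = [:-a, 1:] * ([:-a, 1:] * smult (Polynomial.lead_coeff p) (\<Prod>x\<in>#B. [:-x, 1:]))"
      using A(2) by (metis (no_types, lifting) ab_semigroup_mult_class.mult_ac(1)
          add_mset_add_single image_mset_add_mset mult_smult_right prod_mset.add_mset
          union_mset_add_mset_left add_0 empty_neutral(1))
    then obtain r where r: "p = [:-a, 1:] * ([:-a, 1:] * r)" by blast
    have "poly (pderiv p) a = 0"
      by (subst r) (simp only: pderiv_mult poly_add poly_mult, simp)
    moreover have "poly (pderiv p) a = -1"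
      by (simp add: p_def pderiv_diff pderiv_monom N(1) pderiv_pCons)
    ultimately show False by simp
  qed
  \<comment> \<open>All multiplicities being at most one, the size of the multiset of roots is the
    number of roots.\<close>
  have "A = mset_set (set_mset A)"
  proof (rule multiset_eqI)
    fix x show "count A x = count (mset_set (set_mset A)) x"
      using count_le[of x] by (cases "x \<in># A") (auto simp: not_in_iff le_Suc_eq simp flip: count_greater_zero_iff)
  qed
  hence "card (set_mset A) = N" using A(1) by (metis size_mset_set)
  thus "card {x :: 'b. x ^ N = x} = N" using setA roots by simp
  show "finite {x :: 'b. x ^ N = x}" using setA roots by (metis finite_set_mset)
qed


text \<open>The characteristic is a prime dividing p^s, hence equals p. This makes the q-power map
  an iterate of the Frobenius map.\<close>

lemma card_eq_CHAR_power:
  assumes "primepow CARD('a :: {field, finite})"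
  obtains s where "Factorial_Ring.prime CHAR('a)" "CARD('a) = CHAR('a) ^ s"
proof -
  obtain p s where ps: "Factorial_Ring.prime p" "CARD('a) = p ^ s"
    using assms by (auto simp: primepow_def)
  have "Factorial_Ring.prime CHAR('a)"
    by (intro prime_CHAR_semidom finite_imp_CHAR_pos) auto
  moreover have "CHAR('a) dvd p ^ s"
    using CHAR_dvd_CARD[where 'a = 'a] ps by simp
  ultimately have "CHAR('a) = p"
    using ps(1) prime_dvd_power primes_dvd_imp_eq by blast
  thus ?thesis using that ps \<open>Factorial_Ring.prime CHAR('a)\<close> by simp
qed

text \<open>For \<open>k > 0\<close> this is the subfield of order q^k. It is a set and not a type
  because the degree is a variable. For \<open>k = 0\<close> it is the whole closure, which is why
  the counting lemma assumes \<open>k > 0\<close>.\<close>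

definition frobenius_fixed :: "nat \<Rightarrow> 'a :: {field, finite} alg_closure set"
  where "frobenius_fixed k = {x. x ^ (CARD('a) ^ k) = x}"

lemma frobenius_add:
  fixes x y :: "'a :: {field, finite} alg_closure"
  assumes "primepow CARD('a)"
  shows "(x + y) ^ (CARD('a) ^ k) = x ^ (CARD('a) ^ k) + y ^ (CARD('a) ^ k)"
proof -
  obtain s where s: "Factorial_Ring.prime CHAR('a)" "CARD('a) = CHAR('a) ^ s"
    using card_eq_CHAR_power[OF assms] .
  show ?thesis
    by (rule freshmans_dream'[where n = "s * k"]) (simp_all add: s power_mult)
qed

text \<open>The base field lies in each of these subfields, so they are closed under scalar
  multiplication by it.\<close>

lemma frobenius_fixed_to_ac [simp]: "to_ac c \<in> frobenius_fixed k"
proof -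
  have "c ^ (CARD('a) ^ k) = c" for c :: 'a
    by (induction k) (simp_all add: power_mult finite_field_power_card)
  thus ?thesis
    by (simp add: frobenius_fixed_def flip: to_ac_power)
qed

lemma frobenius_fixed_0 [simp]: "0 \<in> frobenius_fixed k"
  using frobenius_fixed_to_ac[of 0] by simp

lemma frobenius_fixed_1 [simp]: "1 \<in> frobenius_fixed k"
  by (simp add: frobenius_fixed_def)

lemma frobenius_fixed_mult:
  "x \<in> frobenius_fixed k \<Longrightarrow> y \<in> frobenius_fixed k \<Longrightarrow> x * y \<in> frobenius_fixed k"
  by (simp add: frobenius_fixed_def power_mult_distrib)

lemma frobenius_fixed_divide:
  "x \<in> frobenius_fixed k \<Longrightarrow> y \<in> frobenius_fixed k \<Longrightarrow> x / y \<in> frobenius_fixed k"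
  by (simp add: frobenius_fixed_def power_divide)

lemma frobenius_fixed_uminus:
  "x \<in> frobenius_fixed k \<Longrightarrow> - x \<in> frobenius_fixed k"
  using frobenius_fixed_mult[OF frobenius_fixed_to_ac[of "-1"]] by simp

lemma frobenius_fixed_add:
  fixes x :: "'a :: {field, finite} alg_closure"
  assumes "primepow CARD('a)" "x \<in> frobenius_fixed k" "y \<in> frobenius_fixed k"
  shows "x + y \<in> frobenius_fixed k"
  using assms frobenius_add[OF assms(1)] by (simp add: frobenius_fixed_def)

lemma card_frobenius_fixed:
  assumes "k > 0"
  shows "card (frobenius_fixed k :: 'a :: {field, finite} alg_closure set) = CARD('a) ^ k"
    and "finite (frobenius_fixed k :: 'a alg_closure set)"
proof -
  have "CHAR('a) dvd CARD('a) ^ k"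
    using assms CHAR_dvd_CARD[where 'a = 'a] by (metis dvd_power dvd_trans)
  hence "of_nat (CARD('a) ^ k) = (0 :: 'a alg_closure)"
    by (simp only: of_nat_eq_0_iff_char_dvd CHAR_alg_closure)
  moreover have "CARD('a) ^ k > 1"
    using assms by (intro one_less_power) (rule one_less_card_field)
  ultimately show "card (frobenius_fixed k :: 'a alg_closure set) = CARD('a) ^ k"
    and "finite (frobenius_fixed k :: 'a alg_closure set)"
    unfolding frobenius_fixed_def using card_power_fixed_points by blast+
qed

text \<open>The form is the product of y + x t over the three conjugates t of an element
  \<open>a\<close> of degree 3 over K. Its coefficients are symmetric functions of the conjugates,
  so they lie in K, while no linear factor can vanish at a nonzero point of K^2.\<close>

lemma anisotropic_binary_cubic:
  assumes pp: "primepow CARD('a :: {field, finite})" and "m > 0"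
  obtains d e c :: "'a :: {field, finite} alg_closure"
  where "d \<in> frobenius_fixed m" "e \<in> frobenius_fixed m" "c \<in> frobenius_fixed m"
    and "\<And>x y. x \<in> frobenius_fixed m \<Longrightarrow> y \<in> frobenius_fixed m \<Longrightarrow>
          y ^ 3 + d * x * y ^ 2 + e * x ^ 2 * y - c * x ^ 3 = 0 \<Longrightarrow> x = 0 \<and> y = 0"
proof -
  define K where "K = (frobenius_fixed m :: 'a alg_closure set)"
  define \<sigma> where "\<sigma> x = x ^ (CARD('a) ^ m)" for x :: "'a alg_closure"
  have K: "x \<in> K \<longleftrightarrow> \<sigma> x = x" for x
    by (simp add: K_def \<sigma>_def frobenius_fixed_def)
  have \<sigma>_add: "\<sigma> (x + y) = \<sigma> x + \<sigma> y" for x y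
    unfolding \<sigma>_def by (rule frobenius_add[OF pp])
  have \<sigma>_mult: "\<sigma> (x * y) = \<sigma> x * \<sigma> y" for x y
    by (simp add: \<sigma>_def power_mult_distrib)
  \<comment> \<open>A suitable \<open>a\<close> exists because the larger field has more elements
    than K.\<close>
  have "CARD('a) ^ m < CARD('a) ^ (3 * m)"
    using \<open>m > 0\<close> one_less_card_field by (intro power_strict_increasing) auto
  hence "card K < card (frobenius_fixed (3 * m) :: 'a alg_closure set)"
    using \<open>m > 0\<close> by (simp add: card_frobenius_fixed K_def)
  moreover have "finite K"
    using \<open>m > 0\<close> by (simp add: card_frobenius_fixed K_def)
  ultimately have "\<not> frobenius_fixed (3 * m) \<subseteq> K"
    by (meson card_mono not_le)
  then obtain a where a: "a \<in> frobenius_fixed (3 * m)" "a \<notin> K" by blast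
  define b where "b = \<sigma> a"
  define g where "g = \<sigma> b"
  \<comment> \<open>Applying \<open>\<sigma>\<close> three times raises to the power q^(3m), which
    fixes \<open>a\<close>; thus \<open>\<sigma>\<close> permutes \<open>a\<close>,
    \<open>b\<close>, \<open>g\<close> cyclically.\<close>
  have "\<sigma> g = a"
    using a(1) by (simp add: g_def b_def \<sigma>_def frobenius_fixed_def eval_nat_numeral
        power_add mult.assoc flip: power_mult)
  have inj: "\<sigma> x = \<sigma> y \<Longrightarrow> x = y" for x y
    using frobenius_add[OF pp, of "x - y" y m]
    by (simp add: \<sigma>_def)
  \<comment> \<open>If \<open>\<sigma>\<close> fixed \<open>b\<close> or \<open>g\<close>,
    injectivity would make it fix \<open>a\<close> too.\<close>
  have "b \<notin> K" "g \<notin> K"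
    using a(2) inj by (auto simp: K b_def g_def)
  have "a + b + g \<in> K" "a * b + b * g + g * a \<in> K" "a * b * g \<in> K"
    by (auto simp: K \<sigma>_add \<sigma>_mult \<open>\<sigma> g = a\<close> algebra_simps simp flip: b_def g_def)
  have root: "x = 0" if "x \<in> K" "y \<in> K" "t \<notin> K" "y + x * t = 0" for x y t
  proof (rule ccontr)
    assume "x \<noteq> 0"
    hence "t = (- y) / x"
      using that(4) by (simp add: field_simps eq_neg_iff_add_eq_0 add.commute)
    thus False
      using that frobenius_fixed_divide frobenius_fixed_uminus by (metis K_def)
  qed
  show ?thesis
  \<comment> \<open>The last coefficient is negated because the form contains - c x^3, whereas the
    product of the linear factors contains + a b g x^3.\<close>
  proof (rule that[of "a + b + g" "a * b + b * g + g * a" "- (a * b * g)"], fold K_def)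
    fix x y assume xy: "x \<in> K" "y \<in> K"
      "y ^ 3 + (a + b + g) * x * y ^ 2 + (a * b + b * g + g * a) * x ^ 2 * y - - (a * b * g) * x ^ 3 = 0"
    have "(y + x * a) * (y + x * b) * (y + x * g) = 0"
      using xy(3) by (simp add: algebra_simps power2_eq_square power3_eq_cube)
    hence "x = 0"
      using root xy(1,2) a(2) \<open>b \<notin> K\<close> \<open>g \<notin> K\<close> by fastforce
    thus "x = 0 \<and> y = 0" using xy(3) by simp
  qed (use \<open>a + b + g \<in> K\<close> \<open>a * b + b * g + g * a \<in> K\<close> \<open>a * b * g \<in> K\<close>
        frobenius_fixed_uminus in \<open>auto simp: K_def\<close>)
qed

subsection \<open>Coordinates over a finite field\<close>

lemma (in vector_space) independent_sum_eqD:
  assumes "finite B" "independent B" "(\<Sum>v\<in>B. f v *s v) = (\<Sum>v\<in>B. g v *s v)" "v \<in> B"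
  shows "f v = g v"
proof -
  have "(\<Sum>v\<in>B. (f v - g v) *s v) = 0"
    by (simp add: scale_left_diff_distrib sum_subtractf assms(3))
  hence "f v - g v = 0"
    using independentD[OF assms(2,1) subset_refl _ assms(4)] by metis
  thus ?thesis by simp
qed

text \<open>A basis with k elements gives a bijection from k-tuples onto \<open>S\<close>; comparing
  cardinalities then forces k = n.\<close>

lemma finite_subspace_coordinates:
  fixes scale :: "'a :: {field, finite} \<Rightarrow> 'b :: ab_group_add \<Rightarrow> 'b"
  assumes "vector_space scale" "module.subspace scale S" "card S = CARD('a) ^ n"
  obtains b where "bij_betw (\<lambda>v. \<Sum>i<n. scale (v $ i) (b i)) (carrier_vec n) S"
proof -
  interpret vector_space scale by fact
  have S: "subspace S" by fact
  have "finite S" using assms(3) by (intro card_ge_0_finite) simp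
  obtain B where B: "B \<subseteq> S" "independent B" "S \<subseteq> span B" by (rule basis_exists)
  have "finite B" using B(1) \<open>finite S\<close> by (rule finite_subset)
  have "span B = S" using B span_minimal[OF B(1) S] by blast
  define k where "k = card B"
  obtain b where b: "bij_betw b {..<k} B"
    using ex_bij_betw_nat_finite[OF \<open>finite B\<close>] by (auto simp: k_def atLeast0LessThan)
  define \<phi> where "\<phi> v = (\<Sum>i<k. scale (v $ i) (b i))" for v :: "'a vec"
  have bi: "b i \<in> B" if "i < k" for i using b that by (auto simp: bij_betw_def)
  \<comment> \<open>Reindexing the sum by the basis itself puts it in the form to which linear
    independence applies.\<close>
  have \<phi>_B: "\<phi> v = (\<Sum>x\<in>B. scale (v $ the_inv_into {..<k} b x) x)" for v
    unfolding \<phi>_def using b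
    by (intro sum.reindex_bij_betw[OF b, THEN trans[rotated]] sum.cong)
       (auto simp: bij_betw_def the_inv_into_f_f)
  have "bij_betw \<phi> (carrier_vec k) S"
  proof (rule bij_betwI')
    fix v w :: "'a vec" assume vw: "v \<in> carrier_vec k" "w \<in> carrier_vec k"
    have "v = w" if "\<phi> v = \<phi> w"
    proof (rule eq_vecI)
      fix i assume "i < dim_vec w"
      hence i: "i < k" using vw by simp
      have "v $ the_inv_into {..<k} b (b i) = w $ the_inv_into {..<k} b (b i)"
        by (rule independent_sum_eqD[OF \<open>finite B\<close> B(2) that[unfolded \<phi>_B]]) (rule bi[OF i])
      thus "v $ i = w $ i"
        using i b by (simp add: bij_betw_def the_inv_into_f_f)
    qed (use vw in simp)
    thus "\<phi> v = \<phi> w \<longleftrightarrow> v = w" by blast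
  next
    fix v :: "'a vec"
    show "\<phi> v \<in> S"
      unfolding \<phi>_def using bi B(1) S by (auto intro!: subspace_sum subspace_scale)
  next
    fix s assume "s \<in> S"
    then obtain u where "s = (\<Sum>x\<in>B. scale (u x) x)"
      using \<open>span B = S\<close> span_finite[OF \<open>finite B\<close>] by auto
    also have "\<dots> = \<phi> (vec k (\<lambda>i. u (b i)))"
      unfolding \<phi>_def by (subst sum.reindex_bij_betw[OF b, symmetric]) simp
    finally show "\<exists>v\<in>carrier_vec k. s = \<phi> v" by (intro bexI[of _ "vec k (\<lambda>i. u (b i))"]) auto
  qed
  moreover from this have "CARD('a) ^ k = CARD('a) ^ n"
    using assms(3) by (simp add: bij_betw_same_card flip: card_carrier_vec)
  moreover have "CARD('a) > 1"
    by (rule one_less_card_field)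
  ultimately have "bij_betw \<phi> (carrier_vec n) S" "k = n"
    by (auto simp: power_inject_exp)
  thus ?thesis using that unfolding \<phi>_def by blast
qed

text \<open>Every vector is a unique combination of a finite basis \<open>B\<close>, so the space
  has q^|B| elements. Coefficient functions are taken extensional so that values outside
  \<open>B\<close> are not counted.\<close>

lemma dim_eq_if_card_eq:
  assumes "vectorspace (class_ring :: 'a :: {field, finite} ring) V"
    and "card (carrier V) = CARD('a) ^ n"
  shows "vectorspace.dim (class_ring :: 'a ring) V = n"
proof -
  interpret vectorspace "class_ring :: 'a ring" V by fact
  have "CARD('a) > 1"
    by (rule one_less_card_field)
  have "finite (carrier V)" using assms(2) by (intro card_ge_0_finite) simp
  \<comment> \<open>A finite carrier is a finite generating set of itself, which provides a finite
    basis.\<close>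
  moreover have "gen_set (carrier V)"
    using in_own_span[of "carrier V"] span_is_subset2[of "carrier V"] by auto
  ultimately have fin_dim unfolding fin_dim_def by blast
  then obtain B where B: "finite B" "basis B" using finite_basis_exists by blast
  hence BV: "B \<subseteq> carrier V" by (simp add: basis_def)
  have ex1: "\<exists>!a. a \<in> B \<rightarrow>\<^sub>E UNIV \<and> lincomb a B = v" if "v \<in> carrier V" for v
    using basis_criterion[OF B(1) BV] B(2) that by (simp add: class_ring_simps)
  have closed: "lincomb a B \<in> carrier V" for a
    using BV by (intro lincomb_closed) (auto simp: class_ring_simps)
  have "bij_betw (\<lambda>a. lincomb a B) (B \<rightarrow>\<^sub>E (UNIV :: 'a set)) (carrier V)"
    unfolding bij_betw_def
  proof
    show "inj_on (\<lambda>a. lincomb a B) (B \<rightarrow>\<^sub>E (UNIV :: 'a set))"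
      by (rule inj_onI) (metis ex1 closed)
    show "(\<lambda>a. lincomb a B) ` (B \<rightarrow>\<^sub>E (UNIV :: 'a set)) = carrier V"
    proof (intro equalityI subsetI)
      fix v assume "v \<in> carrier V"
      then obtain a where "a \<in> B \<rightarrow>\<^sub>E (UNIV :: 'a set)" "lincomb a B = v"
        using ex1 by metis
      thus "v \<in> (\<lambda>a. lincomb a B) ` (B \<rightarrow>\<^sub>E (UNIV :: 'a set))" by blast
    qed (use closed in auto)
  qed
  hence "card (B \<rightarrow>\<^sub>E (UNIV :: 'a set)) = card (carrier V)" by (rule bij_betw_same_card)
  hence "CARD('a) ^ card B = CARD('a) ^ n"
    using assms(2) B(1) by (simp add: card_PiE)
  hence "card B = n" using \<open>CARD('a) > 1\<close> by (simp add: power_inject_exp)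
  thus ?thesis using dim_basis B by simp
qed

lemma mat_subspaceI:
  assumes "M \<subseteq> carrier_mat n n" "0\<^sub>m n n \<in> M"
    and "\<And>A B. A \<in> M \<Longrightarrow> B \<in> M \<Longrightarrow> A + B \<in> M"
    and "\<And>c A. A \<in> M \<Longrightarrow> c \<cdot>\<^sub>m A \<in> M"
  shows "VectorSpace.subspace class_ring M (square_mat_space TYPE('a :: field) n)"
proof -
  interpret vectorspace "class_ring :: 'a ring" "square_mat_space TYPE('a) n"
    by (rule matrix_vs)
  show ?thesis
    by unfold_locales (use assms in \<open>auto simp: matrix_vs_simps\<close>)
qed

section \<open>Matrices of linear maps in fixed coordinates\<close>

locale coordinates = vector_space scale
  for scale :: "'a :: {field, finite} \<Rightarrow> 'b :: ab_group_add \<Rightarrow> 'b" +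
  fixes n :: nat and b :: "nat \<Rightarrow> 'b" and S :: "'b set"
  assumes bij: "bij_betw (\<lambda>v. \<Sum>i<n. scale (v $ i) (b i)) (carrier_vec n) S"
begin

definition vec_to :: "'a vec \<Rightarrow> 'b"
  where "vec_to v = (\<Sum>i<n. scale (v $ i) (b i))"

text \<open>Only the values of \<open>f\<close> on \<open>S\<close> enter, so a map given on the
  whole type may be used when \<open>S\<close> is merely an invariant subspace.\<close>

definition represents :: "'a mat \<Rightarrow> ('b \<Rightarrow> 'b) \<Rightarrow> bool"
  where "represents A f \<longleftrightarrow> A \<in> carrier_mat n n \<and>
    (\<forall>v\<in>carrier_vec n. vec_to (A *\<^sub>v v) = f (vec_to v))"

lemma bij_vec_to: "bij_betw vec_to (carrier_vec n) S"
  using bij by (simp add: vec_to_def [abs_def])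

lemma vec_to_inject:
  "v \<in> carrier_vec n \<Longrightarrow> w \<in> carrier_vec n \<Longrightarrow> vec_to v = vec_to w \<longleftrightarrow> v = w"
  using bij_vec_to by (auto simp: bij_betw_def inj_on_def)

lemma vec_to_image: "vec_to ` carrier_vec n = S"
  using bij_vec_to by (simp add: bij_betw_def)

lemma vec_to_add:
  "v \<in> carrier_vec n \<Longrightarrow> w \<in> carrier_vec n \<Longrightarrow> vec_to (v + w) = vec_to v + vec_to w"
  by (simp add: vec_to_def scale_left_distrib sum.distrib)

lemma vec_to_smult: "v \<in> carrier_vec n \<Longrightarrow> vec_to (c \<cdot>\<^sub>v v) = scale c (vec_to v)"
  by (simp add: vec_to_def scale_sum_right)

lemma vec_to_0: "vec_to (0\<^sub>v n) = 0"
  by (simp add: vec_to_def)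

lemma b_in: "i < n \<Longrightarrow> b i \<in> S"
proof -
  assume "i < n"
  have "vec_to (unit_vec n i) = (\<Sum>j<n. if j = i then b j else 0)"
    unfolding vec_to_def by (intro sum.cong) (auto simp: unit_vec_def)
  also have "\<dots> = b i" using \<open>i < n\<close> by simp
  finally show ?thesis using vec_to_image by (metis imageI unit_vec_carrier)
qed

text \<open>Column j of the matrix is the coordinate vector of the image of the basis vector
  \<open>b j\<close>.\<close>

lemma representsE:
  assumes "Vector_Spaces.linear scale scale f" "f ` S \<subseteq> S"
  obtains A where "represents A f"
proof -
  interpret Vector_Spaces.linear scale scale f by fact
  have "\<exists>w. w \<in> carrier_vec n \<and> vec_to w = f (b j)" if "j < n" for j
    using b_in[OF that] assms(2) vec_to_image by (metis image_iff image_subset_iff)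
  then obtain w where w: "\<And>j. j < n \<Longrightarrow> w j \<in> carrier_vec n \<and> vec_to (w j) = f (b j)"
    by metis
  define A where "A = mat n n (\<lambda>(i, j). w j $ i)"
  have "vec_to (A *\<^sub>v v) = f (vec_to v)" if v: "v \<in> carrier_vec n" for v
  proof -
    have "vec_to (A *\<^sub>v v) = (\<Sum>i<n. scale (\<Sum>j<n. w j $ i * v $ j) (b i))"
      unfolding vec_to_def A_def using v
      by (intro sum.cong) (auto simp: scalar_prod_def atLeast0LessThan)
    also have "\<dots> = (\<Sum>i<n. \<Sum>j<n. scale (v $ j) (scale (w j $ i) (b i)))"
      by (simp add: scale_sum_left mult.commute)
    also have "\<dots> = (\<Sum>j<n. scale (v $ j) (vec_to (w j)))"
      unfolding vec_to_def by (subst sum.swap) (simp add: scale_sum_right)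
    also have "\<dots> = (\<Sum>j<n. scale (v $ j) (f (b j)))"
      using w by (intro sum.cong) auto
    also have "\<dots> = f (vec_to v)"
      by (simp add: vec_to_def sum scale)
    finally show ?thesis .
  qed
  hence "represents A f" by (simp add: represents_def A_def)
  thus ?thesis by (rule that)
qed

text \<open>Turns an identity between maps on \<open>S\<close> into an identity between matrices,
  whose columns are read off at the unit vectors.\<close>

lemma represents_unique:
  assumes "represents A f" "represents B g" "\<And>s. s \<in> S \<Longrightarrow> f s = g s"
  shows "A = B"
proof -
  have AB: "A \<in> carrier_mat n n" "B \<in> carrier_mat n n"
    using assms by (auto simp: represents_def)
  have eq: "A *\<^sub>v v = B *\<^sub>v v" if "v \<in> carrier_vec n" for v
  proof -
    have "vec_to (A *\<^sub>v v) = vec_to (B *\<^sub>v v)"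
      using assms that vec_to_image by (auto simp: represents_def)
    thus ?thesis using AB that by (subst (asm) vec_to_inject) auto
  qed
  show ?thesis
  proof (rule eq_matI)
    fix i j assume ij: "i < dim_row B" "j < dim_col B"
    have "(A *\<^sub>v unit_vec n j) $ i = (B *\<^sub>v unit_vec n j) $ i"
      using eq by simp
    thus "A $$ (i, j) = B $$ (i, j)" using ij AB by simp
  qed (use AB in auto)
qed

lemma represents_determines:
  "represents A f \<Longrightarrow> represents A g \<Longrightarrow> s \<in> S \<Longrightarrow> f s = g s"
  unfolding vec_to_image[symmetric] represents_def by auto

lemma represents_add:
  assumes "represents A f" "represents B g"
  shows "represents (A + B) (\<lambda>s. f s + g s)"
proof -
  have "vec_to ((A + B) *\<^sub>v v) = f (vec_to v) + g (vec_to v)" if "v \<in> carrier_vec n" for v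
  proof -
    have "(A + B) *\<^sub>v v = A *\<^sub>v v + B *\<^sub>v v"
      using assms that by (intro add_mult_distrib_mat_vec) (auto simp: represents_def)
    moreover have "A *\<^sub>v v \<in> carrier_vec n" "B *\<^sub>v v \<in> carrier_vec n"
      using assms that by (auto simp: represents_def)
    ultimately show ?thesis using assms that by (simp add: vec_to_add represents_def)
  qed
  thus ?thesis using assms by (auto simp: represents_def)
qed

lemma represents_smult:
  assumes "represents A f"
  shows "represents (c \<cdot>\<^sub>m A) (\<lambda>s. scale c (f s))"
proof -
  have "vec_to ((c \<cdot>\<^sub>m A) *\<^sub>v v) = scale c (f (vec_to v))" if "v \<in> carrier_vec n" for v
  proof -
    have "(c \<cdot>\<^sub>m A) *\<^sub>v v = c \<cdot>\<^sub>v (A *\<^sub>v v)"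
      using assms that by (intro eq_vecI)
        (auto simp: represents_def scalar_prod_def sum_distrib_left mult.assoc)
    moreover have "A *\<^sub>v v \<in> carrier_vec n"
      using assms that by (auto simp: represents_def)
    ultimately show ?thesis using assms that by (simp add: vec_to_smult represents_def)
  qed
  thus ?thesis using assms by (auto simp: represents_def)
qed

lemma represents_zero: "represents (0\<^sub>m n n) (\<lambda>_. 0)"
proof -
  have "0\<^sub>m n n *\<^sub>v v = 0\<^sub>v n" if "v \<in> carrier_vec n" for v :: "'a vec"
    using that by (intro eq_vecI) auto
  thus ?thesis by (simp add: represents_def vec_to_0)
qed

text \<open>A determinant vanishes exactly when there is a nonzero kernel vector, and the coordinate
  bijection carries kernel to kernel.\<close>

lemma det_eq_0_iff_represents:
  assumes "represents A f"
  shows "det A = 0 \<longleftrightarrow> (\<exists>s\<in>S. s \<noteq> 0 \<and> f s = 0)"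
proof -
  have A: "A \<in> carrier_mat n n" using assms by (simp add: represents_def)
  have "A *\<^sub>v v = 0\<^sub>v n \<longleftrightarrow> f (vec_to v) = 0" if "v \<in> carrier_vec n" for v
  proof -
    have "A *\<^sub>v v = 0\<^sub>v n \<longleftrightarrow> vec_to (A *\<^sub>v v) = vec_to (0\<^sub>v n)"
      using A that by (subst vec_to_inject) auto
    thus ?thesis using assms that by (simp add: represents_def vec_to_0)
  qed
  moreover have "v = 0\<^sub>v n \<longleftrightarrow> vec_to v = 0" if "v \<in> carrier_vec n" for v
    using vec_to_inject[OF that, of "0\<^sub>v n"] by (simp add: vec_to_0)
  ultimately show ?thesis
    unfolding det_0_iff_vec_prod_zero_field[OF A] vec_to_image[symmetric] by auto
qed

text \<open>The coordinate bijection maps the column space injectively onto the image of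
  \<open>f\<close>, so the column space has q^r elements and its dimension is found by
  counting.\<close>

lemma rank_represents:
  assumes "represents A f" "card (f ` S) = CARD('a) ^ r"
  shows "vec_space.rank n A = r"
proof -
  have A: "A \<in> carrier_mat n n" using assms by (simp add: represents_def)
  interpret V: vec_space "TYPE('a)" n .
  have cols: "set (cols A) \<subseteq> carrier_vec n" using A cols_dim by blast
  have span: "V.span (set (cols A)) = (\<lambda>v. A *\<^sub>v v) ` carrier_vec n"
    using V.col_space_eq[OF A] A by (auto simp: V.col_space_def)
  have "f ` S = vec_to ` (V.span (set (cols A)))"
    unfolding span vec_to_image[symmetric] image_image
    using assms(1) by (intro image_cong) (auto simp: represents_def)
  moreover have "inj_on vec_to (V.span (set (cols A)))"
    using bij_vec_to A unfolding span by (auto simp: bij_betw_def elim!: inj_on_subset)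
  ultimately have "card (V.span (set (cols A))) = CARD('a) ^ r"
    using assms(2) by (simp add: card_image)
  moreover have "vectorspace class_ring (V.span_vs (set (cols A)))"
    using V.span_is_subspace[OF cols] V.subspace_is_vs by simp
  ultimately show ?thesis
    unfolding V.rank_def by (intro dim_eq_if_card_eq) auto
qed

end

subsection \<open>The matrix pencil\<close>

text \<open>The first triple holds the parameters of the displayed matrix, the second is the column
  it multiplies. The expression is bilinear in the two triples.\<close>

fun pencil :: "'k :: field \<Rightarrow> 'k \<Rightarrow> 'k \<Rightarrow> 'k \<times> 'k \<times> 'k \<Rightarrow> 'k \<times> 'k \<times> 'k \<Rightarrow> 'k \<times> 'k \<times> 'k"
  where "pencil d e c (x, y, z) (u, v, w) =
    (y * u + z * v + c * x * w, x * u + (y + d * x) * v + (e * x + z) * w, y * w - x * v)"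

lemma pencil_add_left: "pencil d e c (p + p') s = pencil d e c p s + pencil d e c p' s"
  by (cases p; cases p'; cases s) (simp add: algebra_simps)

lemma pencil_add_right: "pencil d e c p (s + s') = pencil d e c p s + pencil d e c p s'"
  by (cases p; cases s; cases s') (simp add: algebra_simps)

text \<open>Elimination replaces the determinant: if x is nonzero, removing u and v leaves the cubic
  form times w, so w, v and u vanish in turn. If x = 0, the form is y^3, so y is nonzero and the
  system is triangular.\<close>

lemma pencil_eq_0D:
  assumes cubic: "y ^ 3 + d * x * y ^ 2 + e * x ^ 2 * y - c * x ^ 3 \<noteq> 0"
    and eq: "pencil d e c (x, y, z) s = 0"
  shows "s = 0"
proof -
  obtain u v w where s: "s = (u, v, w)" by (cases s)
  have eqs: "y * u + z * v + c * x * w = 0" "x * u + (y + d * x) * v + (e * x + z) * w = 0"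
    "y * w = x * v"
    using eq by (auto simp: s zero_prod_def)
  show ?thesis
  proof (cases "x = 0")
    case True
    with cubic eqs show ?thesis by (auto simp: s zero_prod_def)
  next
    case False
    \<comment> \<open>This combination of the first two equations cancels u.\<close>
    have "x * (y * u + z * v + c * x * w) - y * (x * u + (y + d * x) * v + (e * x + z) * w) = 0"
      using eqs by simp
    hence "z * (x * v) + c * x ^ 2 * w - y * (y + d * x) * v - y * (e * x + z) * w = 0"
      by (simp add: algebra_simps power2_eq_square)
    \<comment> \<open>Another factor x makes v occur only as x v, which the third equation replaces
      by y w. The terms in z then cancel, so z is free.\<close>
    hence "x * (z * (x * v) + c * x ^ 2 * w - y * (y + d * x) * v - y * (e * x + z) * w) = 0"
      by simp
    hence "x * z * (x * v) + c * x ^ 3 * w - y * (y + d * x) * (x * v) - x * y * (e * x + z) * w = 0"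
      by (simp add: algebra_simps power2_eq_square power3_eq_cube)
    hence "- (y ^ 3 + d * x * y ^ 2 + e * x ^ 2 * y - c * x ^ 3) * w = 0"
      unfolding eqs(3)[symmetric] by (simp add: algebra_simps power2_eq_square power3_eq_cube)
    hence "w = 0" using cubic by (metis mult_eq_0_iff neg_equal_0_iff_equal)
    with eqs False show ?thesis by (simp add: s zero_prod_def)
  qed
qed

text \<open>Scalars come from the base field through its embedding, so that K^3 counts as a space of
  dimension 3m rather than 3.\<close>

definition ac_scale3 ::
    "'a :: field \<Rightarrow> 'a alg_closure \<times> 'a alg_closure \<times> 'a alg_closure \<Rightarrow>
      'a alg_closure \<times> 'a alg_closure \<times> 'a alg_closure"
  where "ac_scale3 a = (\<lambda>(u, v, w). (to_ac a * u, to_ac a * v, to_ac a * w))"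

lemma vector_space_ac_scale3: "vector_space ac_scale3"
  by unfold_locales (auto simp: ac_scale3_def algebra_simps)

lemma pencil_scale_left: "pencil d e c (ac_scale3 a p) s = ac_scale3 a (pencil d e c p s)"
  by (cases p; cases s) (simp add: ac_scale3_def algebra_simps)

lemma pencil_scale_right: "pencil d e c p (ac_scale3 a s) = ac_scale3 a (pencil d e c p s)"
  by (cases p; cases s) (simp add: ac_scale3_def algebra_simps)

lemma linear_pencil: "Vector_Spaces.linear ac_scale3 ac_scale3 (pencil d e c p)"
proof -
  interpret vector_space "ac_scale3 :: 'a \<Rightarrow> _" by (rule vector_space_ac_scale3)
  show ?thesis
    by unfold_locales (simp_all add: pencil_add_right pencil_scale_right)
qed

section \<open>The space of matrices\<close>

theorem corollary8:
  fixes q m :: nat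
  assumes "primepow q"
    and "card (UNIV :: 'a :: {field, finite} set) = q"
    and "m > 0"
  shows "\<exists>M :: 'a mat set.
    VectorSpace.subspace class_ring M (square_mat_space TYPE('a) (3 * m)) \<and>
    mat_subspace_dim (3 * m) M = 3 * m \<and>
    VectorSpace.subspace class_ring {A \<in> M. det A = 0} (square_mat_space TYPE('a) (3 * m)) \<and>
    mat_subspace_dim (3 * m) {A \<in> M. det A = 0} = m \<and>
    (\<forall>A \<in> {A \<in> M. det A = 0}. A \<noteq> 0\<^sub>m (3 * m) (3 * m) \<longrightarrow>
       vec_space.rank (3 * m) A = 2 * m)"
proof -
  have pp: "primepow CARD('a)" using assms by simp
  define K where "K = (frobenius_fixed m :: 'a alg_closure set)"
  \<comment> \<open>\<open>S\<close> is both the parameter space and the space acted upon;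
    \<open>Z\<close> collects the parameters with x = y = 0.\<close>
  define S where "S = K \<times> K \<times> K"
  define Z where "Z = {0 :: 'a alg_closure} \<times> {0 :: 'a alg_closure} \<times> K"
  have cardK: "card K = CARD('a) ^ m"
    using card_frobenius_fixed(1) \<open>m > 0\<close> by (simp add: K_def)
  have cardS: "card S = CARD('a) ^ (3 * m)"
    by (simp add: S_def card_cartesian_product cardK eval_nat_numeral power_add)
  have cardZ: "card Z = CARD('a) ^ m"
    by (simp add: Z_def card_cartesian_product cardK)
  have K_closed: "0 \<in> K" "1 \<in> K" "to_ac a \<in> K" "x \<in> K \<Longrightarrow> y \<in> K \<Longrightarrow> x + y \<in> K"
    "x \<in> K \<Longrightarrow> y \<in> K \<Longrightarrow> x * y \<in> K" "x \<in> K \<Longrightarrow> y \<in> K \<Longrightarrow> x / y \<in> K"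
    "x \<in> K \<Longrightarrow> y \<in> K \<Longrightarrow> x - y \<in> K" for a x y
    using frobenius_fixed_add[OF pp, of x m y] frobenius_fixed_add[OF pp, of x m "- y"]
    by (auto simp: K_def frobenius_fixed_mult frobenius_fixed_divide frobenius_fixed_uminus)
  have "Z \<subseteq> S" by (auto simp: S_def Z_def K_closed)
  obtain d e c where dec: "d \<in> K" "e \<in> K" "c \<in> K"
    and cubic: "\<And>x y. x \<in> K \<Longrightarrow> y \<in> K \<Longrightarrow>
          y ^ 3 + d * x * y ^ 2 + e * x ^ 2 * y - c * x ^ 3 = 0 \<Longrightarrow> x = 0 \<and> y = 0"
    using anisotropic_binary_cubic[OF pp \<open>m > 0\<close>] unfolding K_def by metis
  \<comment> \<open>At x = 1, y = 0 the form takes the value -c.\<close>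
  have "c \<noteq> 0" using cubic[of 1 0] K_closed by auto
  define T where "T = pencil d e c"
  interpret vector_space "ac_scale3 :: 'a \<Rightarrow> _" by (rule vector_space_ac_scale3)
  have S_add: "p \<in> S \<Longrightarrow> p' \<in> S \<Longrightarrow> p + p' \<in> S" and S_scale: "p \<in> S \<Longrightarrow> ac_scale3 a p \<in> S"
    for p p' a by (auto simp: S_def ac_scale3_def K_closed)
  have Z_add: "p \<in> Z \<Longrightarrow> p' \<in> Z \<Longrightarrow> p + p' \<in> Z" and Z_scale: "p \<in> Z \<Longrightarrow> ac_scale3 a p \<in> Z"
    for p p' a by (auto simp: Z_def ac_scale3_def K_closed)
  have zero: "0 \<in> S" "0 \<in> Z" by (auto simp: S_def Z_def zero_prod_def K_closed)
  have "subspace S" using S_add S_scale zero by (intro subspaceI) auto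
  then obtain b where "bij_betw (\<lambda>v. \<Sum>i<3 * m. ac_scale3 (v $ i) (b i)) (carrier_vec (3 * m)) S"
    using finite_subspace_coordinates[OF vector_space_ac_scale3 _ cardS] by blast
  then interpret coordinates ac_scale3 "3 * m" b S by unfold_locales
  have "T p ` S \<subseteq> S" if "p \<in> S" for p
    using that dec by (auto simp: S_def T_def K_closed)
  hence "\<forall>p\<in>S. \<exists>A. represents A (T p)"
    unfolding T_def using representsE[OF linear_pencil] by metis
  then obtain F where F: "\<And>p. p \<in> S \<Longrightarrow> represents (F p) (T p)" by metis
  have F_add: "F p + F p' = F (p + p')" if "p \<in> S" "p' \<in> S" for p p'
    by (rule represents_unique[OF represents_add[OF F F] F])
       (use that S_add in \<open>auto simp: T_def pencil_add_left\<close>)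
  have F_scale: "a \<cdot>\<^sub>m F p = F (ac_scale3 a p)" if "p \<in> S" for a p
    by (rule represents_unique[OF represents_smult[OF F] F])
       (use that S_scale in \<open>auto simp: T_def pencil_scale_left\<close>)
  have F_0: "F 0 = 0\<^sub>m (3 * m) (3 * m)"
    by (rule represents_unique[OF F represents_zero])
       (use zero in \<open>auto simp: T_def zero_prod_def\<close>)
  have inj: "inj_on F S"
  proof (rule inj_onI)
    fix p p' assume pp': "p \<in> S" "p' \<in> S" "F p = F p'"
    \<comment> \<open>For p = (x, y, z) this value is (c x, e x + z, y), from which p is recovered
      because c is nonzero.\<close>
    have "T p (0, 0, 1) = T p' (0, 0, 1)"
      by (rule represents_determines[of "F p"])
         (use F[OF pp'(1)] F[OF pp'(2)] pp'(3) in \<open>auto simp: S_def K_closed\<close>)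
    thus "p = p'" using \<open>c \<noteq> 0\<close> by (cases p; cases p') (auto simp: T_def)
  qed
  have det: "det (F p) = 0 \<longleftrightarrow> p \<in> Z" if pS: "p \<in> S" for p
  proof
    assume "det (F p) = 0"
    then obtain s where s: "s \<noteq> 0" "T p s = 0"
      using det_eq_0_iff_represents[OF F[OF pS]] by blast
    obtain x y z where p: "p = (x, y, z)" by (cases p)
    have "y ^ 3 + d * x * y ^ 2 + e * x ^ 2 * y - c * x ^ 3 = 0"
      using pencil_eq_0D[of y d x e c z s] s by (auto simp: T_def p)
    thus "p \<in> Z" using cubic[of x y] pS by (auto simp: p S_def Z_def)
  next
    assume "p \<in> Z"
    \<comment> \<open>The first column of the matrix is (y, x, 0), which is zero for parameters in
      \<open>Z\<close>.\<close>
    hence "T p (1, 0, 0) = 0" by (auto simp: Z_def T_def zero_prod_def)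
    moreover have "(1, 0, 0) \<in> S" by (simp add: S_def K_closed)
    ultimately show "det (F p) = 0"
      unfolding det_eq_0_iff_represents[OF F[OF pS]]
      by (intro bexI[of _ "(1, 0, 0)"]) (auto simp: zero_prod_def)
  qed
  have singular: "{A \<in> F ` S. det A = 0} = F ` Z"
    using det \<open>Z \<subseteq> S\<close> by auto
  \<comment> \<open>Stated for a general \<open>P\<close> so as to serve for both \<open>S\<close>
    and \<open>Z\<close>.\<close>
  have sub: "VectorSpace.subspace class_ring (F ` P) (square_mat_space TYPE('a) (3 * m))"
    and dim: "card P = CARD('a) ^ k \<Longrightarrow> mat_subspace_dim (3 * m) (F ` P) = k"
    if P: "P \<subseteq> S" "0 \<in> P" "\<And>p p'. p \<in> P \<Longrightarrow> p' \<in> P \<Longrightarrow> p + p' \<in> P"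
      "\<And>a p. p \<in> P \<Longrightarrow> ac_scale3 a p \<in> P" for P k
  proof -
    show sub: "VectorSpace.subspace class_ring (F ` P) (square_mat_space TYPE('a) (3 * m))"
    proof (rule mat_subspaceI)
      show "F ` P \<subseteq> carrier_mat (3 * m) (3 * m)"
        using F P(1) by (auto simp: represents_def)
      show "0\<^sub>m (3 * m) (3 * m) \<in> F ` P" using P(2) F_0 by (metis imageI)
    next
      fix A B assume "A \<in> F ` P" "B \<in> F ` P"
      then obtain p p' where "A = F p" "B = F p'" "p \<in> P" "p' \<in> P" by blast
      moreover from this have "F p + F p' = F (p + p')" using P(1) by (intro F_add) auto
      ultimately show "A + B \<in> F ` P" using P(3) by simp
    next
      fix a A assume "A \<in> F ` P"
      then obtain p where "A = F p" "p \<in> P" by blast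
      moreover from this have "a \<cdot>\<^sub>m F p = F (ac_scale3 a p)" using P(1) by (intro F_scale) auto
      ultimately show "a \<cdot>\<^sub>m A \<in> F ` P" using P(4) by simp
    qed
    assume "card P = CARD('a) ^ k"
    hence "card (F ` P) = CARD('a) ^ k"
      using inj_on_subset[OF inj P(1)] by (simp add: card_image)
    thus "mat_subspace_dim (3 * m) (F ` P) = k"
      using vectorspace.subspace_is_vs[OF matrix_vs sub] by (intro dim_eq_if_card_eq) auto
  qed
  have rank: "vec_space.rank (3 * m) A = 2 * m"
    if "A \<in> F ` Z" "A \<noteq> 0\<^sub>m (3 * m) (3 * m)" for A
  proof -
    obtain z where z: "z \<in> K" "A = F (0, 0, z)" using \<open>A \<in> F ` Z\<close> by (auto simp: Z_def)
    have "z \<noteq> 0" using that(2) z(2) F_0 by (auto simp: zero_prod_def)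
    \<comment> \<open>Here the map sends (u, v, w) to (z v, z w, 0), so for nonzero z the image has
      q^(2m) elements.\<close>
    have "T (0, 0, z) ` S = K \<times> K \<times> {0 :: 'a alg_closure}"
    proof (intro equalityI subsetI)
      fix s assume "s \<in> K \<times> K \<times> {0 :: 'a alg_closure}"
      then obtain v w where "s = (v, w, 0)" "v \<in> K" "w \<in> K" by auto
      thus "s \<in> T (0, 0, z) ` S"
        using z(1) \<open>z \<noteq> 0\<close>
        by (intro image_eqI[of _ _ "(0, v / z, w / z)"]) (auto simp: T_def S_def K_closed)
    qed (use z(1) in \<open>auto simp: T_def S_def K_closed\<close>)
    hence "card (T (0, 0, z) ` S) = CARD('a) ^ (2 * m)"
      by (simp add: card_cartesian_product cardK eval_nat_numeral power_add)
    moreover have "(0, 0, z) \<in> S" using z(1) by (simp add: S_def K_closed)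
    ultimately show ?thesis using rank_represents[OF F] z(2) by blast
  qed
  show ?thesis
    by (rule exI[of _ "F ` S"], unfold singular, intro conjI)
       (use rank sub[OF subset_refl zero(1) S_add S_scale] sub[OF \<open>Z \<subseteq> S\<close> zero(2) Z_add Z_scale]
          dim[OF subset_refl zero(1) S_add S_scale cardS]
          dim[OF \<open>Z \<subseteq> S\<close> zero(2) Z_add Z_scale cardZ] in blast)+
qed

end
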